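(* Let $\Omega\subset\mathbb{R}^N$ be open and bounded, and let $J\in GC(\Omega)$ be a functional which is lower semicontinuous on $L^1(\Omega)$ and such that $$J(\chi_{E\cap E'})+J(\chi_{E\cup E'})\le J(\chi_E)+J(\chi_{E'})$$ for every pair of Borel sets $E,E'$ in $\Omega$. Then $J$ is convex.
   Context: $GC(\Omega)$ denotes the class of proper (not identically $+\infty$) functionals $J:L^1(\Omega)\to[0,+\infty]$ satisfying the generalized coarea formula: for every $u\in L^1(\Omega)$, $$J(u)=\int_{-\infty}^{+\infty}J(\chi_{\{u>s\}})\,ds,$$ with the convention $J(u)=+\infty$ if the map $s\mapsto J(\chi_{\{u>s\}})$ is not measurable. *)

theory Defs
  imports "HOL-Analysis.Analysis"
begin

text \<open>
  Elements of \<open>L\<^sup>1(\<Omega>)\<close> are handled through representatives: a functional on \<open>L\<^sup>1(\<Omega>)\<close> is a map on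
  functions whose values on integrable functions do not depend on the representative
  (\<open>L1_functional\<close>). Its values on other functions, and the values of a representative outside
  \<open>\<Omega>\<close>, are irrelevant.
\<close>

definition L1 :: "(real ^ 'n) set \<Rightarrow> (real ^ 'n \<Rightarrow> real) set" where
  "L1 \<Omega> = {u. integrable (lebesgue_on \<Omega>) u}"

definition L1_dist :: "(real ^ 'n) set \<Rightarrow> (real ^ 'n \<Rightarrow> real) \<Rightarrow> (real ^ 'n \<Rightarrow> real) \<Rightarrow> real" where
  "L1_dist \<Omega> u v = (LINT x|lebesgue_on \<Omega>. \<bar>u x - v x\<bar>)"

definition L1_functional :: "(real ^ 'n) set \<Rightarrow> ((real ^ 'n \<Rightarrow> real) \<Rightarrow> ennreal) \<Rightarrow> bool" where
  "L1_functional \<Omega> J \<longleftrightarrow>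
     (\<forall>u\<in>L1 \<Omega>. \<forall>v\<in>L1 \<Omega>. (AE x in lebesgue_on \<Omega>. u x = v x) \<longrightarrow> J u = J v)"

definition level_energy ::
  "(real ^ 'n) set \<Rightarrow> ((real ^ 'n \<Rightarrow> real) \<Rightarrow> ennreal) \<Rightarrow> (real ^ 'n \<Rightarrow> real) \<Rightarrow> real \<Rightarrow> ennreal" where
  "level_energy \<Omega> J u s = J (indicator {x \<in> \<Omega>. u x > s})"

text \<open>
  \<open>GC \<Omega>\<close>: proper functionals satisfying the generalized coarea formula. The case distinction is
  needed because \<open>nn_integral\<close> is also defined, as a lower integral, on non-measurable functions.
  Measurability in \<open>s\<close> is Lebesgue measurability.
\<close>

definition GC :: "(real ^ 'n) set \<Rightarrow> ((real ^ 'n \<Rightarrow> real) \<Rightarrow> ennreal) set" where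
  "GC \<Omega> = {J. L1_functional \<Omega> J \<and>
     (\<exists>u\<in>L1 \<Omega>. J u \<noteq> \<infinity>) \<and>
     (\<forall>u\<in>L1 \<Omega>. J u =
        (if level_energy \<Omega> J u \<in> borel_measurable lebesgue
         then (\<integral>\<^sup>+ s. level_energy \<Omega> J u s \<partial>lebesgue) else \<infinity>))}"

definition lsc_L1 :: "(real ^ 'n) set \<Rightarrow> ((real ^ 'n \<Rightarrow> real) \<Rightarrow> ennreal) \<Rightarrow> bool" where
  "lsc_L1 \<Omega> J \<longleftrightarrow>
     (\<forall>u\<in>L1 \<Omega>. \<forall>c<J u. \<exists>\<delta>>0. \<forall>v\<in>L1 \<Omega>. L1_dist \<Omega> u v < \<delta> \<longrightarrow> c < J v)"

text \<open>
  The library's \<open>convex_on\<close> covers real-valued functions only. In \<open>ennreal\<close>, \<open>0 * \<infinity> = 0\<close>, so the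
  inequality is trivially true for \<open>t = 0\<close> and \<open>t = 1\<close>.
\<close>

definition convex_L1 :: "(real ^ 'n) set \<Rightarrow> ((real ^ 'n \<Rightarrow> real) \<Rightarrow> ennreal) \<Rightarrow> bool" where
  "convex_L1 \<Omega> J \<longleftrightarrow>
     (\<forall>u\<in>L1 \<Omega>. \<forall>v\<in>L1 \<Omega>. \<forall>t\<in>{0..1::real}.
        J (\<lambda>x. (1 - t) * u x + t * v x) \<le> ennreal (1 - t) * J u + ennreal t * J v)"

end

theory Submission
  imports Defs
begin

text \<open>
  On functions with finitely many equispaced values the coarea formula turns \<open>J\<close> into a finite sum
  of energies of level sets. Adding the indicator of a set \<open>B\<close> to such a function can be done one
  level at a time: the part of \<open>B\<close> not absorbed by a level is handed on to the next one, and
  submodularity controls each exchange. Hence \<open>J\<close> is subadditive on step functions with a common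
  step. A general \<open>u\<close> of finite energy is the \<open>L\<^sup>1\<close>-limit of step functions of no larger energy,
  since the Riemann sums of \<open>s \<mapsto> J(\<chi>\<^bsub>{u>s}\<^esub>)\<close> over a grid average, over the offset of the grid, to
  at most \<open>J u\<close>. Approximating \<open>u\<close> with step \<open>h / (1 - t)\<close> and \<open>v\<close> with step \<open>h / t\<close>
  gives \<open>(1 - t) u\<close> and \<open>t v\<close> the common step \<open>h\<close>, and lower semicontinuity concludes.
\<close>

section \<open>Half-lines, rounding to a grid, and averaging over grid offsets\<close>

lemma emeasure_lebesgue_half_line:
  fixes a :: real
  shows "emeasure lebesgue {a..} = \<infinity>" "emeasure lebesgue {..a} = \<infinity>"
proof -
  have top: "x = \<infinity>" if "\<And>n::nat. ennreal (real n) \<le> x" for x :: ennreal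
  proof (rule ccontr)
    assume "x \<noteq> \<infinity>"
    then obtain n :: nat where "x < of_nat n"
      using ennreal_Ex_less_of_nat[of x] by (auto simp: top.not_eq_extremum)
    with that[of n] show False
      by (simp add: ennreal_of_nat_eq_real_of_nat)
  qed
  show "emeasure lebesgue {a..} = \<infinity>"
  proof (rule top)
    fix n :: nat
    have "ennreal (real n) = emeasure lebesgue {a..a + real n}"
      by simp
    also have "\<dots> \<le> emeasure lebesgue {a..}"
      by (rule emeasure_mono) auto
    finally show "ennreal (real n) \<le> emeasure lebesgue {a..}" .
  qed
  show "emeasure lebesgue {..a} = \<infinity>"
  proof (rule top)
    fix n :: nat
    have "ennreal (real n) = emeasure lebesgue {a - real n..a}"
      by simp
    also have "\<dots> \<le> emeasure lebesgue {..a}"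
      by (rule emeasure_mono) auto
    finally show "ennreal (real n) \<le> emeasure lebesgue {..a}" .
  qed
qed

text \<open>Here \<open>q\<close> is \<open>u\<close> rounded to the grid \<open>h * k - c\<close>,
  truncated to \<open>m\<close> steps. Rounding costs at most \<open>h\<close> because
  \<open>r + c\<close> lies in \<open>[0, h)\<close>; truncation only occurs if
  \<open>u < -c + h\<close> or \<open>u > c - h\<close>. The first bound will give a dominating
  function, the second pointwise convergence.\<close>

lemma abs_sample_error:
  fixes u r c h :: real
  assumes h: "0 < h" and c: "0 \<le> c" and r: "-c \<le> r" "r < -c + h"
    and m: "2 * c \<le> h * real m"
  defines "q \<equiv> h * real (min m (nat \<lceil>(u - r) / h\<rceil>)) - c"
  shows "\<bar>q - u\<bar> \<le> \<bar>u\<bar> + h" and "\<bar>u\<bar> \<le> c - h \<Longrightarrow> \<bar>q - u\<bar> \<le> h"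
proof -
  define k where "k = \<lceil>(u - r) / h\<rceil>"
  have "(u - r) / h \<le> of_int k" "of_int k < (u - r) / h + 1"
    unfolding k_def by linarith+
  then have k: "u - r \<le> h * of_int k" "h * of_int k < u - r + h"
    using h by (auto simp: field_simps)
  consider "k \<le> 0" | "0 < k" "nat k \<le> m" | "0 < k" "m < nat k"
    by linarith
  then have *: "\<bar>q - u\<bar> \<le> \<bar>u\<bar> + h \<and> (\<bar>u\<bar> \<le> c - h \<longrightarrow> \<bar>q - u\<bar> \<le> h)"
  proof cases
    case 1
    then have "h * of_int k \<le> 0" using h by (simp add: mult_le_0_iff)
    moreover have "q = - c" using 1 by (simp add: q_def k_def)
    ultimately show ?thesis using k c r h by linarith
  next
    case 2
    then have "q = h * of_int k - c" by (simp add: q_def k_def)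
    then show ?thesis using k c r h by linarith
  next
    case 3
    then have "real m \<le> of_int k" by linarith
    then have "h * real m \<le> h * of_int k" using h by simp
    moreover have "q = h * real m - c" using 3 by (simp add: q_def k_def)
    ultimately show ?thesis using k c r h m by linarith
  qed
  then show "\<bar>q - u\<bar> \<le> \<bar>u\<bar> + h" and "\<bar>u\<bar> \<le> c - h \<Longrightarrow> \<bar>q - u\<bar> \<le> h"
    by auto
qed

text \<open>The ceiling matches the strict inequality in \<open>{u > s}\<close>: levels of the
  rounded function are exact superlevel sets of the original at grid points. Truncation at
  \<open>m\<close> leaves the levels \<open>k < m\<close> untouched.\<close>

lemma less_min_nat_ceiling_iff:
  fixes y r h :: real
  assumes "0 < h" "k < m"
  shows "k < min m (nat \<lceil>(y - r) / h\<rceil>) \<longleftrightarrow> y > r + h * real k"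
proof -
  have "k < min m (nat \<lceil>(y - r) / h\<rceil>) \<longleftrightarrow> int k < \<lceil>(y - r) / h\<rceil>"
    using assms by auto
  also have "\<dots> \<longleftrightarrow> real k < (y - r) / h"
    by (simp add: less_ceiling_iff)
  also have "\<dots> \<longleftrightarrow> y > r + h * real k"
    using assms by (auto simp: field_simps)
  finally show ?thesis .
qed

text \<open>The translates of \<open>[a, a + h)\<close> by \<open>h * k\<close> tile an interval, so
  the sum integrated over all offsets is at most the integral of \<open>f\<close>. Were the bound to
  fail for every offset, it would fail on average.\<close>

lemma exists_sampling_offset:
  fixes f :: "real \<Rightarrow> ennreal"
  assumes f: "f \<in> borel_measurable lebesgue" and fin: "(\<integral>\<^sup>+s. f s \<partial>lebesgue) \<noteq> \<infinity>"
    and h: "0 < h"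
  shows "\<exists>r. a \<le> r \<and> r < a + h \<and>
    ennreal h * (\<Sum>k<m. f (r + h * real k)) \<le> (\<integral>\<^sup>+s. f s \<partial>lebesgue)"
proof (rule ccontr)
  define I where "I = (\<integral>\<^sup>+s. f s \<partial>lebesgue)"
  define F where "F r = ennreal h * (\<Sum>k<m. f (r + h * real k))" for r
  assume "\<not> ?thesis"
  then have gt: "I < F r" if "r \<in> {a..<a + h}" for r
    using that by (auto simp: F_def I_def not_le)
  \<comment> \<open>Since \<open>f\<close> is only Lebesgue measurable, composing it with the
    translation requires the latter to be measurable from \<open>lebesgue\<close> to
    \<open>lebesgue\<close>.\<close>
  have shift[measurable]: "(\<lambda>r. f (r + t)) \<in> borel_measurable lebesgue" for t
  proof -
    have "(\<lambda>r::real. t + r) \<in> lebesgue \<rightarrow>\<^sub>M lebesgue"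
      using lebesgue_affine_measurable[where c = "\<lambda>x::real. 1" and t = t] by simp
    from measurable_compose[OF this f] show ?thesis
      by (simp add: add.commute)
  qed
  have F[measurable]: "F \<in> borel_measurable lebesgue"
    unfolding F_def by measurable
  have meas: "(\<lambda>r. g r * indicator {a..<b} r) \<in> borel_measurable lebesgue"
    if "g \<in> borel_measurable lebesgue" for g :: "real \<Rightarrow> ennreal" and a b
    using that by (intro borel_measurable_times_ennreal borel_measurable_indicator) auto
  have part: "(\<integral>\<^sup>+r. f (r + h * real k) * indicator {a..<a + h} r \<partial>lebesgue)
     = (\<integral>\<^sup>+s. f s * indicator {a + h * real k..<a + h * real (Suc k)} s \<partial>lebesgue)" for k
  proof -
    have "(\<integral>\<^sup>+s. f s * indicator {a + h * real k..<a + h * real (Suc k)} s \<partial>lebesgue)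
      = (\<integral>\<^sup>+r. f (h * real k + r) * indicator {a + h * real k..<a + h * real (Suc k)} (h * real k + r) \<partial>lebesgue)"
      using nn_integral_real_affine_lebesgue[OF meas[OF f],
          where c = 1 and t = "h * real k"] by simp
    also have "\<dots> = (\<integral>\<^sup>+r. f (r + h * real k) * indicator {a..<a + h} r \<partial>lebesgue)"
      by (intro nn_integral_cong) (auto simp: indicator_def algebra_simps)
    finally show ?thesis ..
  qed
  have disj: "(\<Sum>k<m. indicator {a + h * real k..<a + h * real (Suc k)} s)
      = (indicator {a..<a + h * real m} s :: ennreal)" for s
  proof (induction m)
    case (Suc m)
    define z where "z = h * real m"
    have "0 \<le> z" using h by (simp add: z_def)
    moreover have "h * real (Suc m) = z + h" by (simp add: z_def algebra_simps)
    ultimately show ?case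
      using Suc h by (auto simp: indicator_def z_def[symmetric])
  qed auto
  have "(\<integral>\<^sup>+r. F r * indicator {a..<a + h} r \<partial>lebesgue)
     = ennreal h * (\<Sum>k<m. \<integral>\<^sup>+r. f (r + h * real k) * indicator {a..<a + h} r \<partial>lebesgue)"
    unfolding F_def mult.assoc sum_distrib_right
    by (subst nn_integral_cmult nn_integral_sum; (intro borel_measurable_sum meas shift refl)?)+
  also have "\<dots> = ennreal h * (\<integral>\<^sup>+s. f s * indicator {a..<a + h * real m} s \<partial>lebesgue)"
    unfolding part disj[symmetric] sum_distrib_left[of "f _"]
    by (subst nn_integral_sum; (intro meas f refl)?)
  also have "\<dots> \<le> ennreal h * I"
    unfolding I_def by (intro mult_left_mono nn_integral_mono) (auto simp: indicator_def)
  finally have le: "(\<integral>\<^sup>+r. F r * indicator {a..<a + h} r \<partial>lebesgue) \<le> ennreal h * I" .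
  have I: "(\<integral>\<^sup>+r. I * indicator {a..<a + h} r \<partial>lebesgue) = ennreal h * I"
    using h by (simp add: nn_integral_cmult_indicator mult.commute)
  \<comment> \<open>The strict pointwise inequality on a set of positive measure survives
    integration because the smaller integral is finite.\<close>
  have "(\<integral>\<^sup>+r. I * indicator {a..<a + h} r \<partial>lebesgue)
      < (\<integral>\<^sup>+r. F r * indicator {a..<a + h} r \<partial>lebesgue)"
  proof (rule nn_integral_less)
    show "(\<integral>\<^sup>+r. I * indicator {a..<a + h} r \<partial>lebesgue) \<noteq> \<infinity>"
      unfolding I using fin by (simp add: I_def ennreal_mult_eq_top_iff)
    show "AE r in lebesgue. I * indicator {a..<a + h} r \<le> F r * indicator {a..<a + h} r"
      using gt by (intro AE_I2) (auto simp: indicator_def less_imp_le)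
    show "\<not> (AE r in lebesgue. F r * indicator {a..<a + h} r \<le> I * indicator {a..<a + h} r)"
    proof
      assume "AE r in lebesgue. F r * indicator {a..<a + h} r \<le> I * indicator {a..<a + h} r"
      then have "AE r in lebesgue. r \<notin> {a..<a + h}"
        by eventually_elim (use gt in \<open>fastforce simp: indicator_def not_le[symmetric]\<close>)
      then have "emeasure lebesgue {a..<a + h} = 0"
        by (subst (asm) AE_iff_measurable[of "{a..<a + h}"]) auto
      with h show False by simp
    qed
  qed (intro meas F borel_measurable_const)+
  with le I show False by simp
qed

section \<open>Setting, null sets, and submodularity on Lebesgue sets\<close>

locale submodular_coarea =
  fixes \<Omega> :: "(real ^ 'n) set" and J :: "(real ^ 'n \<Rightarrow> real) \<Rightarrow> ennreal"
  assumes open_\<Omega>: "open \<Omega>" and bounded_\<Omega>: "bounded \<Omega>"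
    and GC: "J \<in> GC \<Omega>" and lsc: "lsc_L1 \<Omega> J"
    and submodular_borel: "\<And>E E'. E \<in> sets borel \<Longrightarrow> E \<subseteq> \<Omega> \<Longrightarrow> E' \<in> sets borel \<Longrightarrow> E' \<subseteq> \<Omega> \<Longrightarrow>
           J (indicator (E \<inter> E')) + J (indicator (E \<union> E')) \<le> J (indicator E) + J (indicator E')"
begin

lemma lmeasurable_\<Omega>: "\<Omega> \<in> lmeasurable"
  using open_\<Omega> bounded_\<Omega> by (simp add: lmeasurable_open)

lemma sets_\<Omega>[measurable]: "\<Omega> \<in> sets lebesgue"
  using lmeasurable_\<Omega> by auto

lemma sets_lebesgue_on_\<Omega>: "E \<in> sets (lebesgue_on \<Omega>) \<longleftrightarrow> E \<in> sets lebesgue \<and> E \<subseteq> \<Omega>"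
  by (subst sets_restrict_space_iff) auto

sublocale finite_measure "lebesgue_on \<Omega>"
  using lmeasurable_\<Omega> by (rule finite_measure_lebesgue_on)

lemma J_cong_AE: "u \<in> L1 \<Omega> \<Longrightarrow> v \<in> L1 \<Omega> \<Longrightarrow> AE x in lebesgue_on \<Omega>. u x = v x \<Longrightarrow> J u = J v"
  using GC unfolding GC_def L1_functional_def by blast

lemma coarea: "u \<in> L1 \<Omega> \<Longrightarrow> J u =
        (if level_energy \<Omega> J u \<in> borel_measurable lebesgue
         then (\<integral>\<^sup>+ s. level_energy \<Omega> J u s \<partial>lebesgue) else \<infinity>)"
  using GC unfolding GC_def by blast

text \<open>The value for a non-measurable level energy is infinity, so finiteness of
  \<open>J u\<close> forces measurability.\<close>

lemma coarea_finite:
  assumes "u \<in> L1 \<Omega>" "J u \<noteq> \<infinity>"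
  shows "level_energy \<Omega> J u \<in> borel_measurable lebesgue"
    and "(\<integral>\<^sup>+ s. level_energy \<Omega> J u s \<partial>lebesgue) = J u"
  using coarea[OF assms(1)] assms(2) by (auto split: if_splits)

lemma indicator_L1: "E \<in> sets (lebesgue_on \<Omega>) \<Longrightarrow> indicator E \<in> L1 \<Omega>"
  by (simp add: L1_def less_top[symmetric])

lemma J_indicator_cong:
  assumes "E \<in> sets (lebesgue_on \<Omega>)" "F \<in> sets (lebesgue_on \<Omega>)"
    and "AE x in lebesgue_on \<Omega>. x \<in> E \<longleftrightarrow> x \<in> F"
  shows "J (indicator E) = J (indicator F)"
  using assms by (intro J_cong_AE indicator_L1) (auto elim!: eventually_mono simp: indicator_def)

lemma superlevel_sets:
  fixes u :: "real ^ 'n \<Rightarrow> real"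
  shows "u \<in> L1 \<Omega> \<Longrightarrow> {x \<in> \<Omega>. u x > s} \<in> sets (lebesgue_on \<Omega>)"
proof -
  assume "u \<in> L1 \<Omega>"
  then have [measurable]: "u \<in> borel_measurable (lebesgue_on \<Omega>)"
    by (auto simp: L1_def)
  have "{x \<in> space (lebesgue_on \<Omega>). u x > s} \<in> sets (lebesgue_on \<Omega>)"
    by measurable
  then show ?thesis by simp
qed

text \<open>Superlevel sets of an integrable function are only Lebesgue measurable, while the
  hypothesis concerns Borel sets. Each Lebesgue set agrees with a Borel set up to a null set, which
  \<open>J\<close> does not see.\<close>

lemma submodular:
  assumes E: "E \<in> sets (lebesgue_on \<Omega>)" and E': "E' \<in> sets (lebesgue_on \<Omega>)"
  shows "J (indicator (E \<inter> E')) + J (indicator (E \<union> E')) \<le> J (indicator E) + J (indicator E')"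
proof -
  \<comment> \<open>The approximation is from inside, by an F-sigma subset, so that \<open>C\<close>
    stays within \<Omega>.\<close>
  have ex: "\<exists>C. C \<in> sets borel \<and> C \<subseteq> \<Omega> \<and> C \<in> sets (lebesgue_on \<Omega>)
      \<and> (AE x in lebesgue_on \<Omega>. x \<in> C \<longleftrightarrow> x \<in> A)"
    if A: "A \<in> sets (lebesgue_on \<Omega>)" for A
  proof -
    from A have "A \<in> sets lebesgue" "A \<subseteq> \<Omega>" by (auto simp: sets_lebesgue_on_\<Omega>)
    then obtain C T where C: "fsigma C" "T \<in> null_sets lebesgue" "C \<union> T = A"
      using lebesgue_set_almost_fsigma by metis
    have "C \<in> sets borel" using C(1) by (auto elim!: fsigma.cases)
    moreover have "C \<subseteq> \<Omega>" using C \<open>A \<subseteq> \<Omega>\<close> by auto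
    moreover have "T \<in> null_sets (lebesgue_on \<Omega>)"
      using C \<open>A \<subseteq> \<Omega>\<close> by (subst null_sets_restrict_space) auto
    then have "AE x in lebesgue_on \<Omega>. x \<notin> T"
      by (rule AE_not_in)
    then have "AE x in lebesgue_on \<Omega>. x \<in> C \<longleftrightarrow> x \<in> A"
      by eventually_elim (use C in auto)
    ultimately show ?thesis
      by (auto simp: sets_lebesgue_on_\<Omega>)
  qed
  obtain C C' where C: "C \<in> sets borel" "C \<subseteq> \<Omega>" "C \<in> sets (lebesgue_on \<Omega>)"
      "AE x in lebesgue_on \<Omega>. x \<in> C \<longleftrightarrow> x \<in> E"
    and C': "C' \<in> sets borel" "C' \<subseteq> \<Omega>" "C' \<in> sets (lebesgue_on \<Omega>)"
      "AE x in lebesgue_on \<Omega>. x \<in> C' \<longleftrightarrow> x \<in> E'"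
    using ex[OF E] ex[OF E'] by blast
  have "AE x in lebesgue_on \<Omega>. x \<in> E \<inter> E' \<longleftrightarrow> x \<in> C \<inter> C'"
      "AE x in lebesgue_on \<Omega>. x \<in> E \<union> E' \<longleftrightarrow> x \<in> C \<union> C'"
    using C(4) C'(4) by (eventually_elim; simp)+
  then have "J (indicator (E \<inter> E')) = J (indicator (C \<inter> C'))"
      "J (indicator (E \<union> E')) = J (indicator (C \<union> C'))"
    using C C' E E' by (auto intro!: J_indicator_cong)
  moreover have "J (indicator E) = J (indicator C)" "J (indicator E') = J (indicator C')"
    using C C' E E' by (auto intro!: J_indicator_cong simp: eq_commute)
  ultimately show ?thesis
    using submodular_borel[OF C(1,2) C'(1,2)] by simp
qed

section \<open>Vanishing energy of the empty set and of \<Omega>\<close>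

text \<open>If \<open>J\<close> exceeded some \<open>c > 0\<close> at the indicator of
  \<open>E\<close>, lower semicontinuity would keep it above \<open>c\<close> nearby, hence for a
  set of levels of infinite measure, and the coarea integral of \<open>u\<close> would
  diverge.\<close>

lemma J_indicator_eq_0:
  assumes u: "u \<in> L1 \<Omega>" "J u \<noteq> \<infinity>" and E: "E \<in> sets (lebesgue_on \<Omega>)"
    and near: "\<And>\<delta>. 0 < \<delta> \<Longrightarrow> \<exists>A. A \<in> sets lebesgue \<and> emeasure lebesgue A = \<infinity> \<and>
        (\<forall>s\<in>A. L1_dist \<Omega> (indicator E) (indicator {x \<in> \<Omega>. u x > s}) < \<delta>)"
  shows "J (indicator E) = 0"
proof (rule ccontr)
  assume "J (indicator E) \<noteq> 0"
  then have "0 < J (indicator E)" by (simp add: zero_less_iff_neq_zero)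
  then obtain c where c: "0 < c" "c < J (indicator E)" using dense by blast
  then obtain \<delta> where \<delta>: "0 < \<delta>"
      "\<And>v. v \<in> L1 \<Omega> \<Longrightarrow> L1_dist \<Omega> (indicator E) v < \<delta> \<Longrightarrow> c < J v"
    using lsc indicator_L1[OF E] unfolding lsc_L1_def by metis
  obtain A where A: "A \<in> sets lebesgue" "emeasure lebesgue A = \<infinity>"
      "\<forall>s\<in>A. L1_dist \<Omega> (indicator E) (indicator {x \<in> \<Omega>. u x > s}) < \<delta>"
    using near[OF \<delta>(1)] by blast
  have "\<infinity> = (\<integral>\<^sup>+ s. c * indicator A s \<partial>lebesgue)"
    using A c by (simp add: nn_integral_cmult_indicator ennreal_mult_top)
  also have "\<dots> \<le> (\<integral>\<^sup>+ s. level_energy \<Omega> J u s \<partial>lebesgue)"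
    using A \<delta>(2) superlevel_sets[OF u(1)]
    by (intro nn_integral_mono) (auto simp: indicator_def level_energy_def intro!: less_imp_le indicator_L1)
  also have "\<dots> = J u" using coarea_finite[OF u] by simp
  finally show False using u by (simp add: top_unique)
qed

lemma superlevel_tail:
  assumes u: "u \<in> L1 \<Omega>" and \<delta>: "0 < (\<delta>::real)"
  shows "\<exists>R>0. measure (lebesgue_on \<Omega>) {x \<in> \<Omega>. R \<le> \<bar>u x\<bar>} < \<delta>"
proof -
  define I where "I = (LINT x|lebesgue_on \<Omega>. \<bar>u x\<bar>)"
  have int: "integrable (lebesgue_on \<Omega>) (\<lambda>x. \<bar>u x\<bar>)" using u by (simp add: L1_def)
  have "0 \<le> I" unfolding I_def by simp
  \<comment> \<open>The summand 1 keeps \<open>R\<close> positive and the Markov bound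
    \<open>I / R\<close> strictly below \<delta>, even if \<open>I = 0\<close>.\<close>
  define R where "R = (I + 1) / \<delta>"
  have R: "0 < R" using \<open>0 \<le> I\<close> \<delta> by (simp add: R_def)
  have "measure (lebesgue_on \<Omega>) {x \<in> space (lebesgue_on \<Omega>). R \<le> \<bar>u x\<bar>} \<le> I / R"
    unfolding I_def by (rule integral_Markov_inequality_measure[OF int, of "{}"]) (use R in auto)
  also have "I / R < \<delta>" using \<open>0 \<le> I\<close> \<delta> by (simp add: R_def field_simps)
  finally show ?thesis using R by auto
qed

lemma L1_dist_indicator:
  assumes E: "E \<in> sets (lebesgue_on \<Omega>)" and F: "F \<in> sets (lebesgue_on \<Omega>)"
    and A: "A \<in> sets (lebesgue_on \<Omega>)" and sub: "(E - F) \<union> (F - E) \<subseteq> A"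
  shows "L1_dist \<Omega> (indicator E) (indicator F) \<le> measure (lebesgue_on \<Omega>) A"
proof -
  have "L1_dist \<Omega> (indicator E) (indicator F) \<le> (LINT x|lebesgue_on \<Omega>. indicator A x)"
    unfolding L1_dist_def
  proof (rule integral_mono)
    show "integrable (lebesgue_on \<Omega>) (\<lambda>x. \<bar>indicator E x - indicator F x :: real\<bar>)"
      using indicator_L1[OF E] indicator_L1[OF F] unfolding L1_def by auto
    show "integrable (lebesgue_on \<Omega>) (\<lambda>x. indicator A x :: real)"
      using indicator_L1[OF A] unfolding L1_def by auto
  qed (use sub in \<open>auto simp: indicator_def\<close>)
  also have "\<dots> = measure (lebesgue_on \<Omega>) A"
    using sets.sets_into_space[OF A] by (simp add: Int_absorb2)
  finally show ?thesis .
qed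

text \<open>
  The levels \<open>{u > s}\<close> of a function of finite energy tend to \<open>{}\<close> and \<open>\<Omega>\<close> as \<open>s \<rightarrow> \<plusminus>\<infinity>\<close>; a positive
  value of \<open>J\<close> at either limit would make the coarea integral infinite.
\<close>

lemma J_trivial: "J (indicator {}) = 0" "J (indicator \<Omega>) = 0"
proof -
  \<comment> \<open>Properness enters here: it supplies a function of finite energy.\<close>
  obtain u where u: "u \<in> L1 \<Omega>" "J u \<noteq> \<infinity>"
    using GC unfolding GC_def by blast
  note lev = superlevel_sets[OF u(1)]
  have [measurable]: "u \<in> borel_measurable (lebesgue_on \<Omega>)"
    using u by (auto simp: L1_def)
  have big: "{x \<in> \<Omega>. R \<le> \<bar>u x\<bar>} \<in> sets (lebesgue_on \<Omega>)" for R
  proof -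
    have "{x \<in> space (lebesgue_on \<Omega>). R \<le> \<bar>u x\<bar>} \<in> sets (lebesgue_on \<Omega>)" by measurable
    then show ?thesis by simp
  qed
  show "J (indicator {}) = 0"
  proof (rule J_indicator_eq_0[OF u])
    fix \<delta> :: real assume "0 < \<delta>"
    from superlevel_tail[OF u(1) this] obtain R where
      R: "0 < R" "measure (lebesgue_on \<Omega>) {x \<in> \<Omega>. R \<le> \<bar>u x\<bar>} < \<delta>" by blast
    have "L1_dist \<Omega> (indicator {}) (indicator {x \<in> \<Omega>. u x > s}) < \<delta>" if "s \<in> {R..}" for s
      using that by (intro le_less_trans[OF L1_dist_indicator[OF _ lev big] R(2)]) auto
    then show "\<exists>A. A \<in> sets lebesgue \<and> emeasure lebesgue A = \<infinity> \<and>
        (\<forall>s\<in>A. L1_dist \<Omega> (indicator {}) (indicator {x \<in> \<Omega>. u x > s}) < \<delta>)"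
      by (intro exI[of _ "{R..}"]) (auto simp: emeasure_lebesgue_half_line)
  qed auto
  show "J (indicator \<Omega>) = 0"
  proof (rule J_indicator_eq_0[OF u])
    fix \<delta> :: real assume "0 < \<delta>"
    from superlevel_tail[OF u(1) this] obtain R where
      R: "0 < R" "measure (lebesgue_on \<Omega>) {x \<in> \<Omega>. R \<le> \<bar>u x\<bar>} < \<delta>" by blast
    \<comment> \<open>A point of \<Omega> outside \<open>{u > s}\<close> has
      \<open>u \<le> s \<le> -R\<close>, so it lies in the same tail set as before.\<close>
    have "L1_dist \<Omega> (indicator \<Omega>) (indicator {x \<in> \<Omega>. u x > s}) < \<delta>" if "s \<in> {..-R}" for s
      using that by (intro le_less_trans[OF L1_dist_indicator[OF _ lev big] R(2)])
        (auto simp: sets_lebesgue_on_\<Omega>)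
    then show "\<exists>A. A \<in> sets lebesgue \<and> emeasure lebesgue A = \<infinity> \<and>
        (\<forall>s\<in>A. L1_dist \<Omega> (indicator \<Omega>) (indicator {x \<in> \<Omega>. u x > s}) < \<delta>)"
      by (intro exI[of _ "{..-R}"]) (auto simp: emeasure_lebesgue_half_line)
  qed (auto simp: sets_lebesgue_on_\<Omega>)
qed

section \<open>Energy of step functions and its subadditivity\<close>

definition level_sum :: "(real ^ 'n \<Rightarrow> nat) \<Rightarrow> nat \<Rightarrow> ennreal" where
  "level_sum U m = (\<Sum>k<m. J (indicator {x \<in> \<Omega>. k < U x}))"

lemma L1_step:
  assumes [measurable]: "U \<in> measurable (lebesgue_on \<Omega>) (count_space UNIV)"
    and "\<And>x. U x \<le> m"
  shows "(\<lambda>x. h * real (U x) - c) \<in> L1 \<Omega>"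
  unfolding L1_def mem_Collect_eq
proof (rule integrable_const_bound)
  show "AE x in lebesgue_on \<Omega>. norm (h * real (U x) - c) \<le> \<bar>h\<bar> * real m + \<bar>c\<bar>"
  proof (rule AE_I2)
    fix x
    have "norm (h * real (U x) - c) \<le> \<bar>h\<bar> * real (U x) + \<bar>c\<bar>"
      by (metis abs_mult abs_of_nat abs_triangle_ineq4 real_norm_def)
    also have "\<dots> \<le> \<bar>h\<bar> * real m + \<bar>c\<bar>"
      using assms(2) by (simp add: mult_left_mono)
    finally show "norm (h * real (U x) - c) \<le> \<bar>h\<bar> * real m + \<bar>c\<bar>" .
  qed
qed measurable

text \<open>For \<open>s\<close> in the \<open>k\<close>-th cell of length \<open>h\<close> the
  superlevel set is \<open>{k < U}\<close>. Below \<open>- c\<close> it is \<Omega> and from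
  \<open>h * m - c\<close> on it is empty; these unbounded ranges contribute nothing by
  \<open>J_trivial\<close>.\<close>

lemma J_step:
  assumes U: "U \<in> measurable (lebesgue_on \<Omega>) (count_space UNIV)"
    and bd: "\<And>x. U x \<le> m" and h: "0 < h"
  shows "J (\<lambda>x. h * real (U x) - c) = ennreal h * level_sum U m"
proof -
  let ?u = "\<lambda>x. h * real (U x) - c"
  let ?e = "\<lambda>k. J (indicator {x \<in> \<Omega>. k < U x})"
  let ?I = "\<lambda>k. {h * real k - c ..< h * real (Suc k) - c}"
  have eq: "level_energy \<Omega> J ?u s = (\<Sum>k<m. ?e k * indicator (?I k) s)" for s
  proof -
    consider "s < - c" | k where "k < m" "s \<in> ?I k" | "h * real m - c \<le> s"
    proof -
      assume 1: "s < - c \<Longrightarrow> thesis" and 2: "\<And>k. k < m \<Longrightarrow> s \<in> ?I k \<Longrightarrow> thesis"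
        and 3: "h * real m - c \<le> s \<Longrightarrow> thesis"
      define k where "k = nat \<lfloor>(s + c) / h\<rfloor>"
      show thesis
      proof (cases "s < -c")
        case False
        then have "0 \<le> (s + c) / h" using h by simp
        then have "real k \<le> (s + c) / h" "(s + c) / h < real k + 1"
          unfolding k_def by linarith+
        then have "s \<in> ?I k" using h by (auto simp: field_simps)
        moreover have "h * real m \<le> h * real k" if "\<not> k < m" using that h by simp
        ultimately show thesis using 2 3 by force
      qed (use 1 in auto)
    qed
    then show ?thesis
    proof cases
      case 1
      then have "{x \<in> \<Omega>. ?u x > s} = \<Omega>"
        using h by (auto intro: less_le_trans[OF 1])
      moreover have "s \<notin> ?I k" for k
      proof -
        have "0 \<le> h * real k" using h by simp
        with 1 show ?thesis by auto
      qed
      ultimately show ?thesis by (simp add: level_energy_def J_trivial)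
    next
      case (2 k)
      have "?u x > s \<longleftrightarrow> k < U x" for x
      proof
        assume "?u x > s"
        then have "h * real k < h * real (U x)" using 2 by auto
        then show "k < U x" using h by simp
      next
        assume "k < U x"
        then have "h * real (Suc k) \<le> h * real (U x)"
          using h by (intro mult_left_mono) linarith+
        then show "?u x > s" using 2 by auto
      qed
      moreover have "s \<notin> ?I i" if "i \<noteq> k" for i
      proof
        assume "s \<in> ?I i"
        with 2 have "h * real i < h * real (Suc k)" "h * real k < h * real (Suc i)" by auto
        then have "i < Suc k" "k < Suc i" using h by (simp_all del: of_nat_Suc)
        with that show False by simp
      qed
      then have "(\<Sum>i<m. ?e i * indicator (?I i) s) = (\<Sum>i<m. if i = k then ?e k else 0)"
        using 2 by (intro sum.cong) auto
      ultimately show ?thesis using 2 by (simp add: level_energy_def)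
    next
      case 3
      have "\<not> ?u x > s" for x
      proof -
        have "h * real (U x) \<le> h * real m" using h bd by simp
        with 3 show ?thesis by auto
      qed
      moreover have "s \<notin> ?I k" if "k < m" for k
      proof -
        have "h * real (Suc k) \<le> h * real m"
          using h that by (intro mult_left_mono) linarith+
        with 3 show ?thesis by auto
      qed
      ultimately show ?thesis by (simp add: level_energy_def J_trivial)
    qed
  qed
  have len: "h * real (Suc k) - c - (h * real k - c) = h" for k
    by (simp add: algebra_simps)
  have em: "emeasure lebesgue (?I k) = ennreal h" for k
    using h len[of k] by (simp add: del: of_nat_Suc)
  \<comment> \<open>Measurability must come first: without it the coarea clause would give infinity
    instead of the integral.\<close>
  have "level_energy \<Omega> J ?u \<in> borel_measurable lebesgue"
    unfolding eq[abs_def]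
    by (intro borel_measurable_sum borel_measurable_times_ennreal borel_measurable_indicator) auto
  then have "J ?u = (\<integral>\<^sup>+ s. level_energy \<Omega> J ?u s \<partial>lebesgue)"
    using coarea[OF L1_step[OF U bd]] by simp
  also have "\<dots> = (\<integral>\<^sup>+ s. (\<Sum>k<m. ?e k * indicator (?I k) s) \<partial>lebesgue)"
    by (intro nn_integral_cong eq)
  also have "\<dots> = ennreal h * level_sum U m"
    by (subst nn_integral_sum, (intro borel_measurable_times_ennreal borel_measurable_indicator; simp),
        subst nn_integral_cmult_indicator)
      (simp_all only: em level_sum_def sum_distrib_left mult.commute, simp)
  finally show ?thesis .
qed

lemma level_set_sets:
  assumes "U \<in> measurable (lebesgue_on \<Omega>) (count_space UNIV)"
  shows "{x \<in> \<Omega>. P (U x)} \<in> sets (lebesgue_on \<Omega>)"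
  using measurable_sets[OF assms, of "Collect P"] by (simp add: vimage_def Int_def conj_commute)

text \<open>
  The induction keeps the leftover \<open>B \<inter> {W \<ge> n}\<close> on the left-hand side, so that nothing has to be
  cancelled in \<open>ennreal\<close>.
\<close>

lemma level_sum_add_indicator:
  assumes W: "W \<in> measurable (lebesgue_on \<Omega>) (count_space UNIV)"
    and bd: "\<And>x. W x \<le> m" and B: "B \<in> sets (lebesgue_on \<Omega>)"
  shows "level_sum (\<lambda>x. W x + indicator B x) (Suc m) \<le> level_sum W m + J (indicator B)"
proof -
  have sub: "B \<subseteq> \<Omega>" using B by (simp add: sets_lebesgue_on_\<Omega>)
  have step: "level_sum (\<lambda>x. W x + indicator B x) n + J (indicator {x \<in> B. n \<le> W x})
      \<le> level_sum W n + J (indicator B)" for n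
  proof (induction n)
    case 0
    then show ?case by (simp add: level_sum_def)
  next
    case (Suc n)
    let ?F = "{x \<in> \<Omega>. n < W x}" and ?B = "{x \<in> B. n \<le> W x}"
    have "?B = B \<inter> {x \<in> \<Omega>. n \<le> W x}" using sub by auto
    then have "?B \<in> sets (lebesgue_on \<Omega>)" using B level_set_sets[OF W] by auto
    from submodular[OF level_set_sets[OF W] this, of "\<lambda>i. n < i"]
    have "J (indicator (?F \<inter> ?B)) + J (indicator (?F \<union> ?B)) \<le> J (indicator ?F) + J (indicator ?B)" .
    \<comment> \<open>The union is the \<open>n\<close>-th level of the new function; the
      intersection is the part of \<open>B\<close> handed on to level \<open>Suc n\<close>.\<close>
    moreover have "?F \<union> ?B = {x \<in> \<Omega>. n < W x + indicator B x}"
      using sub by (auto simp: indicator_def)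
    moreover have "?F \<inter> ?B = {x \<in> B. Suc n \<le> W x}"
      using sub by auto
    ultimately have 1: "J (indicator {x \<in> \<Omega>. n < W x + indicator B x}) + J (indicator {x \<in> B. Suc n \<le> W x})
        \<le> J (indicator ?F) + J (indicator ?B)"
      by (simp add: add.commute)
    have "level_sum (\<lambda>x. W x + indicator B x) (Suc n) + J (indicator {x \<in> B. Suc n \<le> W x})
        = level_sum (\<lambda>x. W x + indicator B x) n +
          (J (indicator {x \<in> \<Omega>. n < W x + indicator B x}) + J (indicator {x \<in> B. Suc n \<le> W x}))"
      by (simp add: level_sum_def add.assoc)
    also have "\<dots> \<le> level_sum (\<lambda>x. W x + indicator B x) n + (J (indicator ?F) + J (indicator ?B))"
      using 1 by (rule add_left_mono)
    also have "\<dots> = (level_sum (\<lambda>x. W x + indicator B x) n + J (indicator ?B)) + J (indicator ?F)"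
      by (simp add: ac_simps)
    also have "\<dots> \<le> (level_sum W n + J (indicator B)) + J (indicator ?F)"
      using Suc by (rule add_right_mono)
    also have "\<dots> = level_sum W (Suc n) + J (indicator B)"
      by (simp add: level_sum_def ac_simps)
    finally show ?case .
  qed
  \<comment> \<open>As \<open>W\<close> is at most \<open>m\<close>, the leftover after
    \<open>m\<close> levels is itself the one additional level of the sum.\<close>
  have "\<not> m < W x" for x using bd[of x] by simp
  then have "{x \<in> \<Omega>. m < W x + indicator B x} = {x \<in> B. m \<le> W x}"
    using sub by (auto simp: indicator_def)
  then show ?thesis using step[of m] by (simp add: level_sum_def)
qed

lemma level_sum_cong: "(\<And>x. x \<in> \<Omega> \<Longrightarrow> U x = V x) \<Longrightarrow> level_sum U m = level_sum V m"
  unfolding level_sum_def by (intro sum.cong arg_cong[where f = J] arg_cong[where f = indicator]) auto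

text \<open>\<open>V\<close> is added layer by layer: passing from \<open>min j V\<close> to
  \<open>min (Suc j) V\<close> adds the indicator of \<open>{j < V}\<close>, whose energy is
  precisely the next summand of \<open>level_sum V\<close>.\<close>

lemma level_sum_add:
  assumes U[measurable]: "U \<in> measurable (lebesgue_on \<Omega>) (count_space UNIV)"
    and V[measurable]: "V \<in> measurable (lebesgue_on \<Omega>) (count_space UNIV)"
    and bdU: "\<And>x. U x \<le> m" and bdV: "\<And>x. V x \<le> l"
  shows "level_sum (\<lambda>x. U x + V x) (m + l) \<le> level_sum U m + level_sum V l"
proof -
  have "level_sum (\<lambda>x. U x + min j (V x)) (m + j) \<le> level_sum U m + level_sum V j" for j
  proof (induction j)
    case 0
    then show ?case by (simp add: level_sum_def)
  next
    case (Suc j)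
    let ?B = "{x \<in> \<Omega>. j < V x}"
    have "level_sum (\<lambda>x. U x + min (Suc j) (V x)) (m + Suc j)
       = level_sum (\<lambda>x. (U x + min j (V x)) + indicator ?B x) (Suc (m + j))"
      by (auto intro!: level_sum_cong simp: indicator_def)
    also have "\<dots> \<le> level_sum (\<lambda>x. U x + min j (V x)) (m + j) + J (indicator ?B)"
    proof (rule level_sum_add_indicator)
      show "(\<lambda>x. U x + min j (V x)) \<in> measurable (lebesgue_on \<Omega>) (count_space UNIV)"
        by measurable
      show "?B \<in> sets (lebesgue_on \<Omega>)" by (rule level_set_sets[OF V])
    qed (use bdU in \<open>auto intro: add_mono\<close>)
    also have "\<dots> \<le> (level_sum U m + level_sum V j) + J (indicator ?B)"
      using Suc by (rule add_right_mono)
    also have "\<dots> = level_sum U m + level_sum V (Suc j)"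
      by (simp add: level_sum_def ac_simps)
    finally show ?case .
  qed
  from this[of l] show ?thesis using bdV by (simp add: min_absorb2)
qed

section \<open>Approximation by step functions of no larger energy\<close>

text \<open>The steps \<open>h n\<close> are prescribed because two functions will need proportional
  ones. The approximant takes values \<open>h n * k - real n\<close> although its levels are cut at
  \<open>r n + h n * k\<close>: only the cuts affect the energy, and the shift is less than
  \<open>h n\<close>.\<close>

lemma exists_step_approximation:
  fixes h :: "nat \<Rightarrow> real"
  assumes u: "u \<in> L1 \<Omega>" "J u \<noteq> \<infinity>" and h: "\<And>n. 0 < h n" "h \<longlonglongrightarrow> 0"
  shows "\<exists>U m c. (\<forall>n. U n \<in> measurable (lebesgue_on \<Omega>) (count_space UNIV) \<and> (\<forall>x. U n x \<le> m n)
      \<and> ennreal (h n) * level_sum (U n) (m n) \<le> J u)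
      \<and> (\<lambda>n. L1_dist \<Omega> u (\<lambda>x. h n * real (U n x) - c n)) \<longlonglongrightarrow> 0"
proof -
  have [measurable]: "u \<in> borel_measurable (lebesgue_on \<Omega>)"
    using u by (auto simp: L1_def)
  \<comment> \<open>Enough steps of height \<open>h n\<close> to cover the range from
    \<open>- n\<close> to \<open>n\<close>.\<close>
  define m where "m n = nat \<lceil>2 * real n / h n\<rceil>" for n
  have m: "2 * real n \<le> h n * real (m n)" for n
  proof -
    have "2 * real n / h n \<le> real (m n)" unfolding m_def by linarith
    then show ?thesis using h(1)[of n] by (simp add: field_simps)
  qed
  have "\<forall>n. \<exists>r. - real n \<le> r \<and> r < - real n + h n \<and>
      ennreal (h n) * (\<Sum>k<m n. level_energy \<Omega> J u (r + h n * real k)) \<le> J u"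
    using exists_sampling_offset[OF coarea_finite(1)[OF u]] coarea_finite(2)[OF u] u(2) h(1)
    by metis
  then obtain r where r: "\<And>n. - real n \<le> r n" "\<And>n. r n < - real n + h n"
    "\<And>n. ennreal (h n) * (\<Sum>k<m n. level_energy \<Omega> J u (r n + h n * real k)) \<le> J u"
    by metis
  define U where "U n x = min (m n) (nat \<lceil>(u x - r n) / h n\<rceil>)" for n x
  have meas[measurable]: "U n \<in> measurable (lebesgue_on \<Omega>) (count_space UNIV)" for n
    unfolding U_def by measurable
  have energy: "ennreal (h n) * level_sum (U n) (m n) \<le> J u" for n
    using r(3)[of n] h(1) less_min_nat_ceiling_iff[of "h n"]
    by (simp add: level_sum_def U_def level_energy_def del: min_less_iff_conj)
  have err: "\<bar>h n * real (U n x) - real n - u x\<bar> \<le> \<bar>u x\<bar> + h n"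
      "\<bar>u x\<bar> \<le> real n - h n \<Longrightarrow> \<bar>h n * real (U n x) - real n - u x\<bar> \<le> h n" for n x
    using abs_sample_error[OF h(1) _ r(1,2) m] unfolding U_def by auto
  \<comment> \<open>A uniform bound on the steps makes \<open>\<bar>u\<bar> + K\<close> a dominating
    function, integrable because \<Omega> has finite measure.\<close>
  obtain K where K: "\<And>n. norm (h n) \<le> K"
    using h(2) by (metis BseqE convergentI convergent_imp_Bseq)
  have "(\<lambda>n. LINT x|lebesgue_on \<Omega>. \<bar>u x - (h n * real (U n x) - real n)\<bar>)
      \<longlonglongrightarrow> (LINT x|lebesgue_on \<Omega>. 0)"
  proof (rule integral_dominated_convergence[where w = "\<lambda>x. \<bar>u x\<bar> + K"])
    show "integrable (lebesgue_on \<Omega>) (\<lambda>x. \<bar>u x\<bar> + K)"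
      using u by (auto simp: L1_def)
    show "AE x in lebesgue_on \<Omega>. norm \<bar>u x - (h n * real (U n x) - real n)\<bar> \<le> \<bar>u x\<bar> + K" for n
    proof (rule AE_I2)
      fix x
      show "norm \<bar>u x - (h n * real (U n x) - real n)\<bar> \<le> \<bar>u x\<bar> + K"
        using err(1)[of n x] K[of n] h(1)[of n] by simp
    qed
    show "AE x in lebesgue_on \<Omega>. (\<lambda>n. \<bar>u x - (h n * real (U n x) - real n)\<bar>) \<longlonglongrightarrow> 0"
    proof (rule AE_I2)
      fix x
      \<comment> \<open>Once \<open>n\<close> is at least \<open>\<bar>u x\<bar> + K\<close>,
        truncation no longer affects \<open>x\<close> and the error is at most
        \<open>h n\<close>.\<close>
      have "eventually (\<lambda>n. nat \<lceil>\<bar>u x\<bar> + K\<rceil> \<le> n) sequentially"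
        by (rule eventually_ge_at_top)
      then have "eventually (\<lambda>n. norm \<bar>u x - (h n * real (U n x) - real n)\<bar> \<le> h n) sequentially"
      proof eventually_elim
        case (elim n)
        then have "\<bar>u x\<bar> + K \<le> real n" by linarith
        then have "\<bar>u x\<bar> \<le> real n - h n" using K[of n] h(1)[of n] by simp
        from err(2)[OF this] show ?case by simp
      qed
      then show "(\<lambda>n. \<bar>u x - (h n * real (U n x) - real n)\<bar>) \<longlonglongrightarrow> 0"
        by (rule Lim_null_comparison) (rule h(2))
    qed
  qed measurable
  then have conv: "(\<lambda>n. L1_dist \<Omega> u (\<lambda>x. h n * real (U n x) - real n)) \<longlonglongrightarrow> 0"
    by (simp add: L1_dist_def)
  have bd: "U n x \<le> m n" for n x by (simp add: U_def)
  show ?thesis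
    by (intro exI[of _ U] exI[of _ m] exI[of _ real] conjI allI meas bd energy conv)
qed

section \<open>Passage to the limit and convexity\<close>

text \<open>Sublevel sets of \<open>J\<close> are sequentially closed: lower semicontinuity at
  \<open>c = R\<close> would push nearby values above \<open>R\<close>.\<close>

lemma J_le_of_L1_limit:
  assumes w: "w \<in> L1 \<Omega>" and v: "\<And>n. v n \<in> L1 \<Omega>" "\<And>n. J (v n) \<le> R"
    and lim: "(\<lambda>n. L1_dist \<Omega> w (v n)) \<longlonglongrightarrow> 0"
  shows "J w \<le> R"
proof (rule ccontr)
  assume "\<not> J w \<le> R"
  then obtain \<delta> where \<delta>: "0 < \<delta>" "\<And>v. v \<in> L1 \<Omega> \<Longrightarrow> L1_dist \<Omega> w v < \<delta> \<Longrightarrow> R < J v"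
    using lsc w unfolding lsc_L1_def by (metis not_le)
  from order_tendstoD(2)[OF lim \<delta>(1)] obtain n where "L1_dist \<Omega> w (v n) < \<delta>"
    by (auto simp: eventually_sequentially)
  from \<delta>(2)[OF v(1) this] v(2)[of n] show False by simp
qed

lemma convex_combination_le:
  assumes u: "u \<in> L1 \<Omega>" "J u \<noteq> \<infinity>" and v: "v \<in> L1 \<Omega>" "J v \<noteq> \<infinity>" and t: "0 < t" "t < 1"
  shows "J (\<lambda>x. (1 - t) * u x + t * v x) \<le> ennreal (1 - t) * J u + ennreal t * J v"
proof -
  define h where "h n = inverse (real (Suc n))" for n
  have h: "0 < h n" "h \<longlonglongrightarrow> 0" for n
    unfolding h_def using LIMSEQ_inverse_real_of_nat by auto
  have h': "0 < h n / s" "(\<lambda>n. h n / s) \<longlonglongrightarrow> 0" if "0 < s" for n s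
    using h(1)[of n] tendsto_divide[OF h(2) tendsto_const[of s]] that by auto
  have t': "0 < 1 - t" using t by simp
  obtain U m c where U: "\<And>n. U n \<in> measurable (lebesgue_on \<Omega>) (count_space UNIV)"
      "\<And>n x. U n x \<le> m n" "\<And>n. ennreal (h n / (1 - t)) * level_sum (U n) (m n) \<le> J u"
      "(\<lambda>n. L1_dist \<Omega> u (\<lambda>x. h n / (1 - t) * real (U n x) - c n)) \<longlonglongrightarrow> 0"
    using exists_step_approximation[OF u h'[OF t']] by blast
  obtain V l d where V: "\<And>n. V n \<in> measurable (lebesgue_on \<Omega>) (count_space UNIV)"
      "\<And>n x. V n x \<le> l n" "\<And>n. ennreal (h n / t) * level_sum (V n) (l n) \<le> J v"
      "(\<lambda>n. L1_dist \<Omega> v (\<lambda>x. h n / t * real (V n x) - d n)) \<longlonglongrightarrow> 0"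
    using exists_step_approximation[OF v h'[OF t(1)]] by blast
  define p where "p n x = h n / (1 - t) * real (U n x) - c n" for n x
  define q where "q n x = h n / t * real (V n x) - d n" for n x
  have p: "p n \<in> L1 \<Omega>" and q: "q n \<in> L1 \<Omega>" for n
    unfolding p_def[abs_def] q_def[abs_def]
    by (rule L1_step[OF U(1,2)], rule L1_step[OF V(1,2)])
  have comb: "(\<lambda>x. (1 - t) * a x + t * b x) \<in> L1 \<Omega>" if "a \<in> L1 \<Omega>" "b \<in> L1 \<Omega>" for a b
    using that by (auto simp: L1_def)
  \<comment> \<open>The weights cancel the denominators of the two steps, so the combination is a
    step function with step \<open>h n\<close> and counter \<open>U n + V n\<close>.\<close>
  have pq: "(\<lambda>x. (1 - t) * p n x + t * q n x)
      = (\<lambda>x. h n * real (U n x + V n x) - ((1 - t) * c n + t * d n))" for n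
  proof
    fix x
    have "(1 - t) * p n x = h n * real (U n x) - (1 - t) * c n"
        "t * q n x = h n * real (V n x) - t * d n"
      using t by (simp_all add: p_def q_def right_diff_distrib)
    then show "(1 - t) * p n x + t * q n x = h n * real (U n x + V n x) - ((1 - t) * c n + t * d n)"
      by (simp add: distrib_left)
  qed
  \<comment> \<open>The common factor \<open>h n\<close> is split back into weight times individual
    step, to recover the two energy bounds.\<close>
  have scale: "ennreal (h n) * X = ennreal s * (ennreal (h n / s) * X)" if "0 < s" for n s X
  proof -
    have "ennreal (h n) = ennreal s * ennreal (h n / s)"
      using that h(1)[of n] by (simp add: ennreal_mult[symmetric])
    then show ?thesis by (simp add: mult.assoc)
  qed
  show ?thesis
  proof (rule J_le_of_L1_limit)
    show "(\<lambda>x. (1 - t) * u x + t * v x) \<in> L1 \<Omega>" by (rule comb[OF u(1) v(1)])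
    show "(\<lambda>x. (1 - t) * p n x + t * q n x) \<in> L1 \<Omega>" for n by (rule comb[OF p q])
    show "J (\<lambda>x. (1 - t) * p n x + t * q n x) \<le> ennreal (1 - t) * J u + ennreal t * J v" for n
    proof -
      have sum_meas: "(\<lambda>x. U n x + V n x) \<in> measurable (lebesgue_on \<Omega>) (count_space UNIV)"
        using U(1)[of n] V(1)[of n] by measurable
      have "J (\<lambda>x. (1 - t) * p n x + t * q n x)
          = ennreal (h n) * level_sum (\<lambda>x. U n x + V n x) (m n + l n)"
        unfolding pq by (rule J_step[OF sum_meas _ h(1)]) (use U(2) V(2) in \<open>simp add: add_mono\<close>)
      also have "\<dots> \<le> ennreal (h n) * (level_sum (U n) (m n) + level_sum (V n) (l n))"
        by (intro mult_left_mono level_sum_add U V) simp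
      also have "\<dots> = ennreal (1 - t) * (ennreal (h n / (1 - t)) * level_sum (U n) (m n))
          + ennreal t * (ennreal (h n / t) * level_sum (V n) (l n))"
        unfolding scale[OF t', symmetric] scale[OF t(1), symmetric] by (rule distrib_left)
      also have "\<dots> \<le> ennreal (1 - t) * J u + ennreal t * J v"
        by (intro add_mono mult_left_mono U V) simp_all
      finally show ?thesis .
    qed
    have le: "L1_dist \<Omega> (\<lambda>x. (1 - t) * u x + t * v x) (\<lambda>x. (1 - t) * p n x + t * q n x)
        \<le> (1 - t) * L1_dist \<Omega> u (p n) + t * L1_dist \<Omega> v (q n)" for n
    proof -
      have int: "integrable (lebesgue_on \<Omega>) (\<lambda>x. \<bar>u x - p n x\<bar>)"
          "integrable (lebesgue_on \<Omega>) (\<lambda>x. \<bar>v x - q n x\<bar>)"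
        using u(1) v(1) p[of n] q[of n] by (auto simp: L1_def)
      have "L1_dist \<Omega> (\<lambda>x. (1 - t) * u x + t * v x) (\<lambda>x. (1 - t) * p n x + t * q n x)
          \<le> (LINT x|lebesgue_on \<Omega>. (1 - t) * \<bar>u x - p n x\<bar> + t * \<bar>v x - q n x\<bar>)"
        unfolding L1_dist_def
      proof (rule integral_mono)
        show "integrable (lebesgue_on \<Omega>)
            (\<lambda>x. \<bar>(1 - t) * u x + t * v x - ((1 - t) * p n x + t * q n x)\<bar>)"
          using comb[OF u(1) v(1)] comb[OF p q, of n n] by (auto simp: L1_def)
        show "integrable (lebesgue_on \<Omega>) (\<lambda>x. (1 - t) * \<bar>u x - p n x\<bar> + t * \<bar>v x - q n x\<bar>)"
          using int by auto
        fix x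
        have "(1 - t) * u x + t * v x - ((1 - t) * p n x + t * q n x)
            = (1 - t) * (u x - p n x) + t * (v x - q n x)"
          by (simp add: algebra_simps)
        then show "\<bar>(1 - t) * u x + t * v x - ((1 - t) * p n x + t * q n x)\<bar>
            \<le> (1 - t) * \<bar>u x - p n x\<bar> + t * \<bar>v x - q n x\<bar>"
          using abs_triangle_ineq[of "(1 - t) * (u x - p n x)" "t * (v x - q n x)"] t
          by (simp add: abs_mult)
      qed
      also have "\<dots> = (1 - t) * L1_dist \<Omega> u (p n) + t * L1_dist \<Omega> v (q n)"
        using int by (simp add: L1_dist_def)
      finally show ?thesis .
    qed
    have "(\<lambda>n. (1 - t) * L1_dist \<Omega> u (p n) + t * L1_dist \<Omega> v (q n)) \<longlonglongrightarrow> (1 - t) * 0 + t * 0"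
      using U(4) V(4) unfolding p_def q_def by (intro tendsto_intros)
    then have "(\<lambda>n. (1 - t) * L1_dist \<Omega> u (p n) + t * L1_dist \<Omega> v (q n)) \<longlonglongrightarrow> 0"
      by simp
    then show "(\<lambda>n. L1_dist \<Omega> (\<lambda>x. (1 - t) * u x + t * v x) (\<lambda>x. (1 - t) * p n x + t * q n x)) \<longlonglongrightarrow> 0"
      by (rule tendsto_sandwich[OF _ _ tendsto_const, rotated 2])
        (use le in \<open>auto simp: L1_dist_def\<close>)
  qed
qed

lemma convex: "convex_L1 \<Omega> J"
  unfolding convex_L1_def
proof (intro ballI)
  fix u v and t :: real
  assume u: "u \<in> L1 \<Omega>" and v: "v \<in> L1 \<Omega>" and t: "t \<in> {0..1}"
  show "J (\<lambda>x. (1 - t) * u x + t * v x) \<le> ennreal (1 - t) * J u + ennreal t * J v"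
  \<comment> \<open>With both weights positive, an infinite energy makes the right-hand side
    infinite. At an endpoint the combination is \<open>u\<close> or \<open>v\<close> itself, and
    \<open>0 * \<infinity> = 0\<close> removes the other term.\<close>
  proof (cases "0 < t \<and> t < 1")
    case True
    then show ?thesis
      using convex_combination_le[OF u _ v]
      by (cases "J u = \<infinity> \<or> J v = \<infinity>") (auto simp: ennreal_mult_top)
  next
    case False
    with t have "t = 0 \<or> t = 1" by auto
    then show ?thesis by auto
  qed
qed

end

theorem proposition3p4:
  fixes \<Omega> :: "(real ^ 'n) set"
    and J :: "(real ^ 'n \<Rightarrow> real) \<Rightarrow> ennreal"
  assumes "open \<Omega>" and "bounded \<Omega>"
    and "J \<in> GC \<Omega>"
    and "lsc_L1 \<Omega> J"
    and "\<And>E E'. E \<in> sets borel \<Longrightarrow> E \<subseteq> \<Omega> \<Longrightarrow> E' \<in> sets borel \<Longrightarrow> E' \<subseteq> \<Omega> \<Longrightarrow>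
           J (indicator (E \<inter> E')) + J (indicator (E \<union> E')) \<le> J (indicator E) + J (indicator E')"
  shows "convex_L1 \<Omega> J"
proof -
  interpret submodular_coarea \<Omega> J
    by unfold_locales (use assms in auto)
  show ?thesis by (rule convex)
qed

end
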